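(* Let $P$ be a $d$-dimensional zero-one matrix with a corner $1$-entry. Then for all positive integers $s$ and $n$, $$f(sn,P,d)\ge \frac{s^{d-1}}{(d-1)!}\,f(n,P,d).$$
   Context: A $d$-dimensional $n_1\times\cdots\times n_d$ zero-one matrix is an array $A=(a_{i_1,\ldots,i_d})$, $1\le i_\ell\le n_\ell$, with entries in $\{0,1\}$. A submatrix is obtained by selecting, for each $\ell$, a set of values of the $\ell$-th coordinate (keeping the order). $A$ contains a $d$-dimensional zero-one matrix $B$ if some submatrix of $A$ can be transformed into $B$ by changing any number of ones to zeros; otherwise $A$ avoids $B$. $f(n,B,d)$ denotes the maximum number of ones in a $d$-dimensional $n\times\cdots\times n$ zero-one matrix that avoids $B$. A corner entry of a $k_1\times\cdots\times k_d$ matrix $P=(p_{i_1,\ldots,i_d})$ is an entry $p_{i_1,\ldots,i_d}$ with $i_\tau\in\{1,k_\tau\}$ for every $1\le\tau\le d$; a corner $1$-entry is a corner entry equal to $1$. *)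

theory Defs
  imports Complex_Main "HOL-Library.FuncSet"
begin

text \<open>
  Indices are 1-based. A multi-index is a function on \<open>{1..d}\<close>, made \<open>undefined\<close> elsewhere,
  so that multi-indices correspond exactly to tuples \<open>(i_1, ..., i_d)\<close>. Of a size vector \<open>k\<close>
  only the values \<open>k 1, ..., k d\<close> matter.
\<close>

definition index_box :: "nat \<Rightarrow> (nat \<Rightarrow> nat) \<Rightarrow> (nat \<Rightarrow> nat) set" where
  "index_box d k = (\<Pi>\<^sub>E l\<in>{1..d}. {1..k l})"

definition zero_one_matrix :: "nat \<Rightarrow> (nat \<Rightarrow> nat) \<Rightarrow> ((nat \<Rightarrow> nat) \<Rightarrow> nat) \<Rightarrow> bool" where
  "zero_one_matrix d k A \<longleftrightarrow> A \<in> index_box d k \<rightarrow>\<^sub>E {0, 1}"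

definition num_ones :: "nat \<Rightarrow> (nat \<Rightarrow> nat) \<Rightarrow> ((nat \<Rightarrow> nat) \<Rightarrow> nat) \<Rightarrow> nat" where
  "num_ones d k A = card {i \<in> index_box d k. A i = 1}"

text \<open>
  \<open>S l\<close> is the set of selected values of the \<open>l\<close>-th coordinate; position \<open>j\<close> of the submatrix in
  direction \<open>l\<close> is the \<open>j\<close>-th smallest element of \<open>S l\<close> (lists are 0-based).
\<close>

definition submatrix ::
  "nat \<Rightarrow> (nat \<Rightarrow> nat set) \<Rightarrow> ((nat \<Rightarrow> nat) \<Rightarrow> nat) \<Rightarrow> (nat \<Rightarrow> nat) \<Rightarrow> nat" where
  "submatrix d S A =
    (\<lambda>j \<in> index_box d (\<lambda>l. card (S l)). A (\<lambda>l \<in> {1..d}. sorted_list_of_set (S l) ! (j l - 1)))"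

definition contains ::
  "nat \<Rightarrow> (nat \<Rightarrow> nat) \<Rightarrow> ((nat \<Rightarrow> nat) \<Rightarrow> nat) \<Rightarrow> (nat \<Rightarrow> nat) \<Rightarrow> ((nat \<Rightarrow> nat) \<Rightarrow> nat) \<Rightarrow> bool" where
  "contains d m A k B \<longleftrightarrow>
    (\<exists>S. (\<forall>l\<in>{1..d}. S l \<subseteq> {1..m l} \<and> card (S l) = k l) \<and>
         (\<forall>j\<in>index_box d k. B j \<noteq> submatrix d S A j \<longrightarrow> submatrix d S A j = 1 \<and> B j = 0))"

abbreviation avoids ::
  "nat \<Rightarrow> (nat \<Rightarrow> nat) \<Rightarrow> ((nat \<Rightarrow> nat) \<Rightarrow> nat) \<Rightarrow> (nat \<Rightarrow> nat) \<Rightarrow> ((nat \<Rightarrow> nat) \<Rightarrow> nat) \<Rightarrow> bool" where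
  "avoids d m A k B \<equiv> \<not> contains d m A k B"

text \<open>
  \<open>ex_num n k B d\<close> is \<open>f(n, B, d)\<close> for \<open>B\<close> of size \<open>k 1 \<times> \<dots> \<times> k d\<close>. The maximum ranges over a
  finite set, which is nonempty whenever \<open>B\<close> has a 1-entry (the zero matrix then avoids \<open>B\<close>).
\<close>

definition ex_num :: "nat \<Rightarrow> (nat \<Rightarrow> nat) \<Rightarrow> ((nat \<Rightarrow> nat) \<Rightarrow> nat) \<Rightarrow> nat \<Rightarrow> nat" where
  "ex_num n k B d =
    Max {num_ones d (\<lambda>_. n) A |A. zero_one_matrix d (\<lambda>_. n) A \<and> avoids d (\<lambda>_. n) A k B}"

definition corner_index :: "nat \<Rightarrow> (nat \<Rightarrow> nat) \<Rightarrow> (nat \<Rightarrow> nat) \<Rightarrow> bool" where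
  "corner_index d k i \<longleftrightarrow> i \<in> index_box d k \<and> (\<forall>l\<in>{1..d}. i l \<in> {1, k l})"

definition has_corner_one :: "nat \<Rightarrow> (nat \<Rightarrow> nat) \<Rightarrow> ((nat \<Rightarrow> nat) \<Rightarrow> nat) \<Rightarrow> bool" where
  "has_corner_one d k P \<longleftrightarrow> (\<exists>i. corner_index d k i \<and> P i = 1)"

end

theory Submission
  imports Defs
begin

text \<open>
  Take a maximal \<open>n \<times> \<dots> \<times> n\<close> matrix \<open>A\<close> avoiding \<open>P\<close> and place copies of it as blocks in the positions
  of an antichain of the \<open>s \<times> \<dots> \<times> s\<close> grid, ordered by distance from the corner. A fixed coordinate
  sum \<open>s - 1\<close> gives an antichain of \<open>(s + d - 2) choose (d - 1) \<ge> s ^ (d - 1) / (d - 1)!\<close> blocks.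
  All 1-entries of a copy of \<open>P\<close> lie in the block of the corner 1-entry, since their blocks are
  comparable to it.

  Outer slices of \<open>P\<close> without 1-entries would let such a copy use coordinates outside the block.
  So let \<open>\<Prod>{a l..b l}\<close> be the bounding box of the 1-entries of \<open>P\<close>. In an \<open>m \<times> \<dots> \<times> m\<close> matrix only
  the core \<open>\<Prod>{a l..m - (k l - b l)}\<close> can meet a copy of \<open>P\<close> in its 1-entries. The blocks are copies
  of the core of \<open>A\<close>, and everything outside the core of the large matrix is filled with ones; this
  shell is at least \<open>s ^ (d - 1)\<close> times as large as that of \<open>A\<close>.
\<close>

section \<open>Containment as a system of strictly increasing coordinate maps\<close>

definition ones :: "nat \<Rightarrow> (nat \<Rightarrow> nat) \<Rightarrow> ((nat \<Rightarrow> nat) \<Rightarrow> nat) \<Rightarrow> (nat \<Rightarrow> nat) set" where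
  "ones d k A = {i \<in> index_box d k. A i = 1}"

text \<open>Maps replace selected sets, and only the positions of ones are kept. Domain
  \<open>I\<close> and target \<open>J\<close> are separate parameters so that both can be cut down
  to the core.\<close>

definition occurs ::
  "nat \<Rightarrow> (nat \<Rightarrow> nat set) \<Rightarrow> (nat \<Rightarrow> nat set) \<Rightarrow> (nat \<Rightarrow> nat) set \<Rightarrow> (nat \<Rightarrow> nat) set \<Rightarrow> bool" where
  "occurs d I J Q X \<longleftrightarrow>
    (\<exists>\<phi>. (\<forall>l\<in>{1..d}. strict_mono_on (I l) (\<phi> l) \<and> \<phi> l ` I l \<subseteq> J l) \<and>
         (\<forall>j\<in>Q. (\<lambda>l\<in>{1..d}. \<phi> l (j l)) \<in> X))"

lemma occursI:
  assumes "\<And>l. l \<in> {1..d} \<Longrightarrow> strict_mono_on (I l) (\<phi> l)"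
    and "\<And>l t. l \<in> {1..d} \<Longrightarrow> t \<in> I l \<Longrightarrow> \<phi> l t \<in> J l"
    and "\<And>j. j \<in> Q \<Longrightarrow> (\<lambda>l\<in>{1..d}. \<phi> l (j l)) \<in> X"
  shows "occurs d I J Q X"
  unfolding occurs_def by (intro exI[of _ \<phi>] conjI ballI image_subsetI assms)

lemma occursE:
  assumes "occurs d I J Q X"
  obtains \<phi> where "\<And>l. l \<in> {1..d} \<Longrightarrow> strict_mono_on (I l) (\<phi> l)"
    "\<And>l t. l \<in> {1..d} \<Longrightarrow> t \<in> I l \<Longrightarrow> \<phi> l t \<in> J l"
    "\<And>j. j \<in> Q \<Longrightarrow> (\<lambda>l\<in>{1..d}. \<phi> l (j l)) \<in> X"
proof -
  obtain \<phi> where "\<forall>l\<in>{1..d}. strict_mono_on (I l) (\<phi> l) \<and> \<phi> l ` I l \<subseteq> J l"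
    "\<forall>j\<in>Q. (\<lambda>l\<in>{1..d}. \<phi> l (j l)) \<in> X"
    using assms unfolding occurs_def by (elim exE conjE)
  then show thesis by (intro that[of \<phi>]) (simp_all add: image_subset_iff)
qed

lemma finite_index_box: "finite (index_box d k)"
  by (simp add: index_box_def finite_PiE)

lemma num_ones_eq_card_ones: "num_ones d k A = card (ones d k A)"
  by (simp add: num_ones_def ones_def)

lemma sorted_list_of_set_image_nth:
  fixes f :: "nat \<Rightarrow> nat"
  assumes "strict_mono_on {1..k} f" "t \<in> {1..k}"
  shows "sorted_list_of_set (f ` {1..k}) ! (t - 1) = f t"
proof -
  have "sorted_list_of_set (f ` {1..k}) = map f [1..<Suc k]"
  proof (rule sorted_distinct_set_unique)
    show "sorted (map f [1..<Suc k])"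
      unfolding sorted_map
    proof (rule sorted_wrt_mono_rel)
      show "sorted_wrt (<) [1..<Suc k]" by (rule sorted_wrt_upt)
      show "f x \<le> f y" if "x \<in> set [1..<Suc k]" "y \<in> set [1..<Suc k]" "x < y" for x y
        using strict_mono_onD[OF assms(1), of x y] that by (simp del: upt_Suc)
    qed
    show "distinct (map f [1..<Suc k])"
      using strict_mono_on_imp_inj_on[OF assms(1)]
      by (simp add: distinct_map atLeastLessThanSuc_atLeastAtMost del: upt_Suc)
    show "set (sorted_list_of_set (f ` {1..k})) = set (map f [1..<Suc k])"
      by (simp add: atLeastLessThanSuc_atLeastAtMost del: upt_Suc)
  qed simp_all
  then show ?thesis using assms(2) by (auto simp del: upt_Suc)
qed

text \<open>Selecting \<open>k l\<close> values in direction \<open>l\<close> amounts to a strictly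
  increasing map on \<open>{1..k l}\<close>, by sorting one way and taking the image the other way.
  Zeros of \<open>B\<close> impose no condition, since ones of \<open>A\<close> may be changed to
  zeros.\<close>

lemma contains_iff_occurs:
  assumes A: "zero_one_matrix d m A" and B: "zero_one_matrix d k B"
  shows "contains d m A k B \<longleftrightarrow>
    occurs d (\<lambda>l. {1..k l}) (\<lambda>l. {1..m l}) (ones d k B) (ones d m A)"
proof
  assume "contains d m A k B"
  then obtain S where S: "\<And>l. l \<in> {1..d} \<Longrightarrow> S l \<subseteq> {1..m l} \<and> card (S l) = k l"
    and AB: "\<And>j. j \<in> index_box d k \<Longrightarrow> B j \<noteq> submatrix d S A j \<Longrightarrow> submatrix d S A j = 1 \<and> B j = 0"
    unfolding contains_def by metis
  define \<phi> where "\<phi> l t = sorted_list_of_set (S l) ! (t - 1)" for l t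
  have fin: "finite (S l)" if "l \<in> {1..d}" for l
    using S[OF that] finite_subset by blast
  have mono: "strict_mono_on {1..k l} (\<phi> l)" if "l \<in> {1..d}" for l
  proof (rule strict_mono_onI)
    fix r t assume "r \<in> {1..k l}" "t \<in> {1..k l}" "r < t"
    then have "r - 1 < t - 1" "t - 1 < length (sorted_list_of_set (S l))"
      using S[OF that] by auto
    then show "\<phi> l r < \<phi> l t"
      unfolding \<phi>_def using strict_sorted_list_of_set[of "S l"] by (simp add: sorted_wrt_iff_nth_less)
  qed
  have mem: "\<phi> l t \<in> {1..m l}" if l: "l \<in> {1..d}" and t: "t \<in> {1..k l}" for l t
  proof -
    have "\<phi> l t \<in> set (sorted_list_of_set (S l))"
      unfolding \<phi>_def using t S[OF l] by (intro nth_mem) auto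
    then show ?thesis using S[OF l] fin[OF l] by auto
  qed
  have box: "index_box d (\<lambda>l. card (S l)) = index_box d k"
    unfolding index_box_def using S by (intro PiE_cong) auto
  have "(\<lambda>l\<in>{1..d}. \<phi> l (j l)) \<in> ones d m A" if j: "j \<in> ones d k B" for j
  proof -
    have jb: "j \<in> index_box d k" "B j = 1" using j by (auto simp: ones_def)
    have "submatrix d S A j = 1" using AB[OF jb(1)] jb(2) by metis
    then have "A (\<lambda>l\<in>{1..d}. \<phi> l (j l)) = 1"
      using jb(1) by (simp add: submatrix_def box \<phi>_def)
    moreover have "(\<lambda>l\<in>{1..d}. \<phi> l (j l)) \<in> index_box d m"
      using jb(1) mem unfolding index_box_def by (auto simp: PiE_iff)
    ultimately show ?thesis by (simp add: ones_def)
  qed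
  with mono mem show "occurs d (\<lambda>l. {1..k l}) (\<lambda>l. {1..m l}) (ones d k B) (ones d m A)"
    by (rule occursI)
next
  assume "occurs d (\<lambda>l. {1..k l}) (\<lambda>l. {1..m l}) (ones d k B) (ones d m A)"
  then obtain \<phi> where mono: "\<And>l. l \<in> {1..d} \<Longrightarrow> strict_mono_on {1..k l} (\<phi> l)"
    and mem: "\<And>l t. l \<in> {1..d} \<Longrightarrow> t \<in> {1..k l} \<Longrightarrow> \<phi> l t \<in> {1..m l}"
    and one: "\<And>j. j \<in> ones d k B \<Longrightarrow> (\<lambda>l\<in>{1..d}. \<phi> l (j l)) \<in> ones d m A"
    by (rule occursE) (rule that)
  define S where "S l = \<phi> l ` {1..k l}" for l
  have card: "card (S l) = k l" if "l \<in> {1..d}" for l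
    using card_image[OF strict_mono_on_imp_inj_on[OF mono[OF that]]] by (simp add: S_def)
  have box: "index_box d (\<lambda>l. card (S l)) = index_box d k"
    unfolding index_box_def using card by (intro PiE_cong) auto
  have sub: "submatrix d S A j = A (\<lambda>l\<in>{1..d}. \<phi> l (j l))" if j: "j \<in> index_box d k" for j
  proof -
    have "(\<lambda>l\<in>{1..d}. sorted_list_of_set (S l) ! (j l - 1)) = (\<lambda>l\<in>{1..d}. \<phi> l (j l))"
      using j mono unfolding S_def index_box_def
      by (intro restrict_ext sorted_list_of_set_image_nth) (auto simp: PiE_iff)
    then show ?thesis using j by (simp add: submatrix_def box)
  qed
  \<comment> \<open>Entries are 0 or 1 and ones of \<open>B\<close> lie over ones of
    \<open>A\<close>, so a mismatch can only be a 0 of \<open>B\<close> over a 1 of the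
    submatrix.\<close>
  have entry: "submatrix d S A j = 1 \<and> B j = 0"
    if j: "j \<in> index_box d k" and neq: "B j \<noteq> submatrix d S A j" for j
  proof -
    have "(\<lambda>l\<in>{1..d}. \<phi> l (j l)) \<in> index_box d m"
      using j mem unfolding index_box_def by (auto simp: PiE_iff)
    then have "submatrix d S A j \<in> {0, 1}"
      using A sub[OF j] unfolding zero_one_matrix_def by (metis PiE_mem)
    moreover have "B j \<in> {0, 1}"
      using B j unfolding zero_one_matrix_def by (metis PiE_mem)
    moreover have "B j = 1 \<Longrightarrow> submatrix d S A j = 1"
      using one[of j] j sub[OF j] by (simp add: ones_def)
    ultimately show ?thesis using neq by auto
  qed
  have sel: "S l \<subseteq> {1..m l}" if "l \<in> {1..d}" for l
    using mem[OF that] unfolding S_def by blast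
  show "contains d m A k B"
    unfolding contains_def
    by (intro exI[of _ S] conjI[OF ballI[OF conjI] ballI[OF impI]] sel card entry)
qed

section \<open>Reduction to the core\<close>

text \<open>Each unit step of the argument raises a strictly increasing integer value by at least
  one.\<close>

lemma strict_mono_on_interval_diff_le:
  fixes f :: "nat \<Rightarrow> nat"
  assumes f: "strict_mono_on {p..q} f" and "p \<le> r" "r \<le> t" "t \<le> q"
  shows "f r + (t - r) \<le> f t"
  using \<open>r \<le> t\<close> \<open>t \<le> q\<close>
proof (induction t rule: dec_induct)
  case (step t)
  have "f t < f (Suc t)" using strict_mono_onD[OF f, of t "Suc t"] step.hyps step.prems \<open>p \<le> r\<close> by simp
  moreover have "f r + (t - r) \<le> f t" using step.IH step.prems by simp
  ultimately show ?case using step.hyps by linarith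
qed simp

text \<open>A strictly increasing map on \<open>{1..k}\<close> has at least \<open>a - 1\<close> values below the image of \<open>a\<close> and
  \<open>k - b\<close> values above that of \<open>b\<close>; conversely this much room suffices to extend it.\<close>

lemma occurs_core_iff:
  assumes ab: "\<And>l. l \<in> {1..d} \<Longrightarrow> 1 \<le> a l \<and> a l \<le> b l \<and> b l \<le> k l"
    and Q: "Q \<subseteq> (\<Pi> l\<in>{1..d}. {a l..b l})"
  shows "occurs d (\<lambda>l. {1..k l}) (\<lambda>l. {1..m}) Q X \<longleftrightarrow>
    occurs d (\<lambda>l. {a l..b l}) (\<lambda>l. {a l..m - (k l - b l)}) Q X"
proof
  assume "occurs d (\<lambda>l. {1..k l}) (\<lambda>l. {1..m}) Q X"
  then obtain \<phi> where mono: "\<And>l. l \<in> {1..d} \<Longrightarrow> strict_mono_on {1..k l} (\<phi> l)"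
    and mem: "\<And>l t. l \<in> {1..d} \<Longrightarrow> t \<in> {1..k l} \<Longrightarrow> \<phi> l t \<in> {1..m}"
    and X: "\<And>j. j \<in> Q \<Longrightarrow> (\<lambda>l\<in>{1..d}. \<phi> l (j l)) \<in> X"
    by (rule occursE) (rule that)
  have "\<phi> l t \<in> {a l..m - (k l - b l)}" if l: "l \<in> {1..d}" and t: "t \<in> {a l..b l}" for l t
  proof -
    have "\<phi> l 1 + (t - 1) \<le> \<phi> l t" "\<phi> l t + (k l - t) \<le> \<phi> l (k l)"
      by (rule strict_mono_on_interval_diff_le[OF mono[OF l]]; use ab[OF l] t in simp)+
    moreover have "1 \<le> \<phi> l 1" "\<phi> l (k l) \<le> m"
      using mem[OF l, of 1] mem[OF l, of "k l"] ab[OF l] by auto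
    ultimately show ?thesis using ab[OF l] t by auto
  qed
  moreover have "strict_mono_on {a l..b l} (\<phi> l)" if "l \<in> {1..d}" for l
    using mono[OF that] ab[OF that] by (auto intro: monotone_on_subset)
  ultimately show "occurs d (\<lambda>l. {a l..b l}) (\<lambda>l. {a l..m - (k l - b l)}) Q X"
    using X by (intro occursI)
next
  assume "occurs d (\<lambda>l. {a l..b l}) (\<lambda>l. {a l..m - (k l - b l)}) Q X"
  then obtain \<phi> where mono: "\<And>l. l \<in> {1..d} \<Longrightarrow> strict_mono_on {a l..b l} (\<phi> l)"
    and mem: "\<And>l t. l \<in> {1..d} \<Longrightarrow> t \<in> {a l..b l} \<Longrightarrow> \<phi> l t \<in> {a l..m - (k l - b l)}"
    and X: "\<And>j. j \<in> Q \<Longrightarrow> (\<lambda>l\<in>{1..d}. \<phi> l (j l)) \<in> X"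
    by (rule occursE) (rule that)
  \<comment> \<open>The extension is the identity below \<open>a l\<close>, and above
    \<open>b l\<close> it packs the values against the upper end, with \<open>k l\<close> going to
    \<open>m\<close>.\<close>
  define \<psi> where "\<psi> l t = (if t < a l then t else if t \<le> b l then \<phi> l t else m - (k l - t))" for l t
  have room: "a l \<le> \<phi> l t" "\<phi> l t + (k l - b l) \<le> m" if l: "l \<in> {1..d}" and "t \<in> {a l..b l}" for l t
  proof -
    have "\<phi> l t \<in> {a l..m - (k l - b l)}" using mem that by blast
    then show "a l \<le> \<phi> l t" "\<phi> l t + (k l - b l) \<le> m" using ab[OF l] by auto
  qed
  have "strict_mono_on {1..k l} (\<psi> l)" if l: "l \<in> {1..d}" for l
  proof (rule strict_mono_onI)
    fix r t assume rt: "r \<in> {1..k l}" "t \<in> {1..k l}" "r < t"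
    \<comment> \<open>The room at \<open>a l\<close> excludes truncation: for \<open>t > b l\<close>
      the value \<open>m - (k l - t)\<close> exceeds \<open>a l\<close>.\<close>
    have m: "a l + (k l - b l) \<le> m" using room[OF l, of "a l"] ab[OF l] by auto
    show "\<psi> l r < \<psi> l t"
      using rt ab[OF l] m room[OF l, of r] room[OF l, of t] strict_mono_onD[OF mono[OF l], of r t]
      by (auto simp: \<psi>_def)
  qed
  moreover have "\<psi> l t \<in> {1..m}" if l: "l \<in> {1..d}" and t: "t \<in> {1..k l}" for l t
  proof -
    have m: "a l + (k l - b l) \<le> m" using room[OF l, of "a l"] ab[OF l] by auto
    then show ?thesis using t ab[OF l] room[OF l, of t] by (auto simp: \<psi>_def)
  qed
  moreover have "(\<lambda>l\<in>{1..d}. \<psi> l (j l)) = (\<lambda>l\<in>{1..d}. \<phi> l (j l))" if "j \<in> Q" for j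
    using Pi_mem[OF subsetD[OF Q that]] by (intro restrict_ext) (fastforce simp: \<psi>_def)
  ultimately show "occurs d (\<lambda>l. {1..k l}) (\<lambda>l. {1..m}) Q X"
    using X by (intro occursI[of d _ \<psi>]) simp_all
qed

section \<open>Large antichains in the grid\<close>

text \<open>The right-hand side is the product \<open>(t + 1) * ... * (t + m)\<close>, whose
  \<open>m\<close> factors are all at least \<open>t + 1\<close>.\<close>

lemma power_le_fact_mult_binomial: "(t + 1) ^ m \<le> fact m * ((t + m) choose m)" for t m :: nat
proof (induction m)
  case (Suc m)
  have "fact (Suc m) * ((t + Suc m) choose Suc m) = fact m * ((Suc (t + m) choose Suc m) * Suc m)"
    by (simp only: fact_Suc of_nat_id add_Suc_right ac_simps)
  also have "\<dots> = Suc (t + m) * (fact m * ((t + m) choose m))"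
    unfolding Suc_times_binomial_eq[symmetric] by (simp only: ac_simps)
  also have "\<dots> \<ge> (t + 1) * (t + 1) ^ m"
    using Suc by (intro mult_mono) auto
  finally show ?case by simp
qed simp

text \<open>\<open>T\<close> marks the directions in which the order is the usual one. Reflecting
  the other coordinates turns the mixed order into the componentwise order, for which vectors of
  equal sum form an antichain.\<close>

lemma ex_large_antichain:
  assumes "d \<ge> 1" "s \<ge> 1"
  obtains N where "N \<subseteq> {1..d} \<rightarrow>\<^sub>E {..<s}" "s ^ (d - 1) \<le> fact (d - 1) * card N"
    "\<forall>p\<in>N. \<forall>q\<in>N. (\<forall>l\<in>{1..d}. if T l then p l \<le> q l else q l \<le> p l) \<longrightarrow> p = q"
proof -
  \<comment> \<open>Lists make the count of vectors with given sum available as stars and bars;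
    \<open>g\<close> turns them into grid points, reflecting the directions outside
    \<open>T\<close>.\<close>
  define L where "L = {xs :: nat list. length xs = d \<and> sum_list xs = s - 1}"
  define g :: "nat list \<Rightarrow> nat \<Rightarrow> nat"
    where "g xs = (\<lambda>l\<in>{1..d}. if T l then xs ! (l - 1) else s - 1 - xs ! (l - 1))" for xs
  have le: "xs ! (l - 1) \<le> s - 1" if "xs \<in> L" "l \<in> {1..d}" for xs l
  proof -
    have "xs ! (l - 1) \<le> sum_list xs"
      using that by (intro elem_le_sum_list) (auto simp: L_def)
    then show ?thesis using that by (auto simp: L_def)
  qed
  have eqI: "xs = ys" if xs: "xs \<in> L" and ys: "ys \<in> L"
    and comp: "\<And>l. l \<in> {1..d} \<Longrightarrow> if T l then g xs l \<le> g ys l else g ys l \<le> g xs l" for xs ys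
  proof -
    have nth: "xs ! i \<le> ys ! i" if "i < d" for i
      using comp[of "Suc i"] le[OF xs, of "Suc i"] le[OF ys, of "Suc i"] that
      by (auto simp: g_def split: if_splits)
    \<comment> \<open>Componentwise inequality together with equal sums forces equality.\<close>
    have "(\<Sum>i<d. xs ! i) = (\<Sum>i<d. ys ! i)"
      using xs ys by (auto simp: L_def sum_list_sum_nth atLeast0LessThan)
    then have "xs ! i = ys ! i" if "i < d" for i
      using sum_mono_inv[of "\<lambda>i. xs ! i" "{..<d}" "\<lambda>i. ys ! i" i] nth that by auto
    then show ?thesis using xs ys by (auto simp: L_def intro: nth_equalityI)
  qed
  have "inj_on g L" by (rule inj_onI) (auto intro: eqI)
  then have "card (g ` L) = card L" by (rule card_image)
  also have "\<dots> = (s - 1 + (d - 1)) choose (s - 1)"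
    using card_length_sum_list[of d "s - 1"] assms by (simp add: L_def)
  also have "\<dots> = (s - 1 + (d - 1)) choose (d - 1)"
    by (subst binomial_symmetric) auto
  finally have card: "s ^ (d - 1) \<le> fact (d - 1) * card (g ` L)"
    using power_le_fact_mult_binomial[of "s - 1" "d - 1"] assms by simp
  have box: "g xs \<in> {1..d} \<rightarrow>\<^sub>E {..<s}" if "xs \<in> L" for xs
  proof -
    have "xs ! (l - 1) < s" if "l \<in> {1..d}" for l
      using le[OF \<open>xs \<in> L\<close> that] assms(2) by linarith
    then show ?thesis using assms(2) by (simp add: g_def PiE_iff)
  qed
  have anti: "\<forall>p\<in>g ` L. \<forall>q\<in>g ` L.
      (\<forall>l\<in>{1..d}. if T l then p l \<le> q l else q l \<le> p l) \<longrightarrow> p = q"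
  proof (intro ballI impI, elim imageE)
    fix p q xs ys
    assume comp: "\<forall>l\<in>{1..d}. if T l then p l \<le> q l else q l \<le> p l"
      and L: "xs \<in> L" "ys \<in> L" and pq: "p = g xs" "q = g ys"
    have "xs = ys" by (rule eqI[OF L]) (rule comp[unfolded pq, THEN bspec])
    then show "p = q" by (simp add: pq)
  qed
  show thesis by (rule that[OF image_subsetI[OF box] card anti])
qed

section \<open>Growth of the shell\<close>

text \<open>The difference counts the points of a cube outside a core that loses \<open>c l\<close>
  slices in direction \<open>l\<close>. The extra factor \<open>s\<close> on the right stands for
  the exponent \<open>card L - 1\<close> on the left and keeps the induction free of subtraction in
  exponents.\<close>

lemma shell_scaling:
  fixes s n :: nat and c :: "'a \<Rightarrow> nat"
  assumes "finite L" "s \<ge> 1"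
  shows "s ^ card L * (n ^ card L - (\<Prod>l\<in>L. n - c l)) \<le>
    s * ((s * n) ^ card L - (\<Prod>l\<in>L. s * n - c l))"
  using assms(1)
proof (induction L rule: finite_induct)
  case (insert x L)
  \<comment> \<open>Splitting off direction \<open>x\<close>: a core slice meets the shell of one
    dimension less, and the remaining \<open>min (c x) N\<close> slices are full. The minimum is
    \<open>N - (N - c x)\<close> and so is right also when \<open>c x > N\<close>.\<close>
  have step: "N ^ Suc (card L) - (N - c x) * (\<Prod>l\<in>L. N - c l) =
      (N - c x) * (N ^ card L - (\<Prod>l\<in>L. N - c l)) + min (c x) N * N ^ card L" for N
  proof -
    have "(\<Prod>l\<in>L. N - c l) \<le> (\<Prod>l\<in>L. N)" by (intro prod_mono) auto
    then have le: "(\<Prod>l\<in>L. N - c l) \<le> N ^ card L" by simp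
    have "N * N ^ card L = (N - c x) * N ^ card L + min (c x) N * N ^ card L"
      by (simp add: min_def flip: add_mult_distrib)
    then show ?thesis using le by (simp add: diff_mult_distrib2)
  qed
  let ?D = "\<lambda>N. N ^ card L - (\<Prod>l\<in>L. N - c l)"
  have "s ^ Suc (card L) * ((n - c x) * ?D n + min (c x) n * n ^ card L) =
      s * (n - c x) * (s ^ card L * ?D n) + s * (min (c x) n * (s * n) ^ card L)"
    by (simp add: algebra_simps power_mult_distrib)
  also have "\<dots> \<le> (s * n - c x) * (s * ?D (s * n)) + s * (min (c x) (s * n) * (s * n) ^ card L)"
  proof (rule add_mono)
    have c: "c x \<le> s * c x" and n: "n \<le> s * n" using assms(2) by auto
    have "s * (n - c x) \<le> s * n - c x"
      unfolding diff_mult_distrib2 by (rule diff_le_mono2[OF c])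
    then show "s * (n - c x) * (s ^ card L * ?D n) \<le> (s * n - c x) * (s * ?D (s * n))"
      using insert.IH by (rule mult_le_mono)
    show "s * (min (c x) n * (s * n) ^ card L) \<le> s * (min (c x) (s * n) * (s * n) ^ card L)"
      using n by (intro mult_le_mono min.mono order_refl)
  qed
  also have "\<dots> = s * ((s * n - c x) * ?D (s * n) + min (c x) (s * n) * (s * n) ^ card L)"
    by (simp add: algebra_simps)
  finally show ?case using insert.hyps by (simp add: step del: power_Suc)
qed simp

section \<open>Copies placed in blocks\<close>

text \<open>Translation to the block with grid position \<open>q\<close>, where blocks have width
  \<open>w l\<close> in direction \<open>l\<close>. Position 0 means no translation.\<close>

definition shift :: "nat \<Rightarrow> (nat \<Rightarrow> nat) \<Rightarrow> (nat \<Rightarrow> nat) \<Rightarrow> (nat \<Rightarrow> nat) \<Rightarrow> nat \<Rightarrow> nat" where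
  "shift d w q x = (\<lambda>l\<in>{1..d}. x l + q l * w l)"

text \<open>Division with remainder by \<open>w l\<close>, after subtracting \<open>a l\<close>,
  recovers the block and the position inside it.\<close>

lemma inj_on_shift:
  assumes N: "N \<subseteq> {1..d} \<rightarrow>\<^sub>E U" and X: "X \<subseteq> (\<Pi>\<^sub>E l\<in>{1..d}. {a l..<a l + w l})"
  shows "inj_on (\<lambda>(q, x). shift d w q x) (N \<times> X)"
proof (rule inj_onI, clarify)
  fix p x q y
  assume p: "p \<in> N" and q: "q \<in> N" and x: "x \<in> X" and y: "y \<in> X"
    and eq: "shift d w p x = shift d w q y"
  have pt: "p l = q l \<and> x l = y l" if l: "l \<in> {1..d}" for l
  proof -
    have xy: "x l \<in> {a l..<a l + w l}" "y l \<in> {a l..<a l + w l}" using X x y l by blast+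
    have "x l + p l * w l = y l + q l * w l"
      using fun_cong[OF eq, of l] l by (simp add: shift_def)
    then have eq': "x l - a l + p l * w l = y l - a l + q l * w l" using xy by auto
    have block: "(t + r * w l) div w l = r" if "t < w l" for t r using that by simp
    have "x l - a l < w l" "y l - a l < w l" using xy by auto
    then have "p l = q l" using eq' block by metis
    then show ?thesis using eq' xy by auto
  qed
  have "p = q" using subsetD[OF N p] subsetD[OF N q] by (rule PiE_ext) (simp add: pt)
  moreover have "x = y" using subsetD[OF X x] subsetD[OF X y] by (rule PiE_ext) (simp add: pt)
  ultimately show "p = q \<and> x = y" ..
qed

text \<open>All other 1-entries lie on one side of the corner \<open>i\<close> in every direction. Hence in a copy
  of \<open>Q\<close> their blocks lie on one side of the block of \<open>i\<close>, and equal it because \<open>N\<close> is an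
  antichain for that order.\<close>

lemma occurs_shifts_imp_occurs:
  assumes Q: "Q \<subseteq> (\<Pi> l\<in>{1..d}. {a l..b l})"
    and Qa: "\<And>l. l \<in> {1..d} \<Longrightarrow> \<exists>j\<in>Q. j l = a l"
    and Qb: "\<And>l. l \<in> {1..d} \<Longrightarrow> \<exists>j\<in>Q. j l = b l"
    and i: "i \<in> Q" "\<And>l. l \<in> {1..d} \<Longrightarrow> i l = a l \<or> i l = b l"
    and X: "X \<subseteq> (\<Pi>\<^sub>E l\<in>{1..d}. {a l..<a l + w l})"
    and anti: "\<forall>p\<in>N. \<forall>q\<in>N.
      (\<forall>l\<in>{1..d}. if i l = a l then p l \<le> q l else q l \<le> p l) \<longrightarrow> p = q"
    and occ: "occurs d (\<lambda>l. {a l..b l}) J Q (\<Union>q\<in>N. shift d w q ` X)"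
  shows "occurs d (\<lambda>l. {a l..b l}) (\<lambda>l. {a l..<a l + w l}) Q X"
proof -
  have mem_Q: "j l \<in> {a l..b l}" if "j \<in> Q" "l \<in> {1..d}" for j l
    using Pi_mem[OF subsetD[OF Q that(1)] that(2)] .
  obtain \<phi> where mono: "\<And>l. l \<in> {1..d} \<Longrightarrow> strict_mono_on {a l..b l} (\<phi> l)"
    and mem: "\<And>j. j \<in> Q \<Longrightarrow> (\<lambda>l\<in>{1..d}. \<phi> l (j l)) \<in> (\<Union>q\<in>N. shift d w q ` X)"
    using occ by (rule occursE) (rule that)
  have "\<exists>q x. q \<in> N \<and> x \<in> X \<and> (\<lambda>l\<in>{1..d}. \<phi> l (j l)) = shift d w q x" if "j \<in> Q" for j
    using mem[OF that] by blast
  then obtain q x where N: "\<And>j. j \<in> Q \<Longrightarrow> q j \<in> N" and xX: "\<And>j. j \<in> Q \<Longrightarrow> x j \<in> X"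
    and eq: "\<And>j. j \<in> Q \<Longrightarrow> (\<lambda>l\<in>{1..d}. \<phi> l (j l)) = shift d w (q j) (x j)"
    by metis
  have val: "\<phi> l (j l) = x j l + q j l * w l" if "j \<in> Q" "l \<in> {1..d}" for j l
    using fun_cong[OF eq[OF that(1)], of l] that(2) by (simp add: shift_def)
  have rng: "x j l \<in> {a l..<a l + w l}" if "j \<in> Q" "l \<in> {1..d}" for j l
    using X xX[OF that(1)] that(2) by blast
  \<comment> \<open>Writing the block as a quotient makes it monotone in the value of
    \<open>\<phi> l\<close>.\<close>
  have block: "q j l = (\<phi> l (j l) - a l) div w l" if "j \<in> Q" "l \<in> {1..d}" for j l
  proof -
    have "\<phi> l (j l) - a l = (x j l - a l) + q j l * w l" "x j l - a l < w l"
      using val[OF that] rng[OF that] by auto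
    then show ?thesis by simp
  qed
  have leD: "\<phi> l t \<le> \<phi> l u" if "l \<in> {1..d}" "t \<in> {a l..b l}" "u \<in> {a l..b l}" "t \<le> u" for l t u
    using strict_mono_on_leD[OF mono[OF that(1)] that(2-4)] .
  have same: "q i = q j" if j: "j \<in> Q" for j
  proof (rule anti[rule_format, OF N[OF i(1)] N[OF j]])
    fix l assume l: "l \<in> {1..d}"
    have "i l = a l \<Longrightarrow> \<phi> l (i l) \<le> \<phi> l (j l)" "i l = b l \<Longrightarrow> \<phi> l (j l) \<le> \<phi> l (i l)"
      using mem_Q[OF i(1) l] mem_Q[OF j l] by (auto intro!: leD[OF l])
    then show "if i l = a l then q i l \<le> q j l else q j l \<le> q i l"
      using i(2)[OF l] unfolding block[OF i(1) l] block[OF j l]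
      by (auto intro!: div_le_mono diff_le_mono)
  qed
  \<comment> \<open>The first and last slices each hold an element of \<open>Q\<close>, which lies
    in the block of \<open>i\<close>. Monotonicity then confines every value of
    \<open>\<phi> l\<close> to that block, including those at coordinates that no element of
    \<open>Q\<close> uses.\<close>
  have bounds: "a l + q i l * w l \<le> \<phi> l t" "\<phi> l t < a l + w l + q i l * w l"
    if l: "l \<in> {1..d}" and t: "t \<in> {a l..b l}" for l t
  proof -
    obtain j where j: "j \<in> Q" "j l = a l" using Qa[OF l] by blast
    have "a l + q i l * w l \<le> \<phi> l (a l)"
      using val[OF j(1) l] rng[OF j(1) l] same[OF j(1)] j(2) by simp
    also have "\<dots> \<le> \<phi> l t" using t by (intro leD[OF l]) auto
    finally show "a l + q i l * w l \<le> \<phi> l t" .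
    obtain j where j: "j \<in> Q" "j l = b l" using Qb[OF l] by blast
    have "\<phi> l t \<le> \<phi> l (b l)" using t by (intro leD[OF l]) auto
    also have "\<dots> < a l + w l + q i l * w l"
      using val[OF j(1) l] rng[OF j(1) l] same[OF j(1)] j(2) by simp
    finally show "\<phi> l t < a l + w l + q i l * w l" .
  qed
  show ?thesis
  \<comment> \<open>Undoing the translation of the single block \<open>q i\<close> yields a copy
    inside \<open>X\<close>.\<close>
  proof (rule occursI[of d _ "\<lambda>l t. \<phi> l t - q i l * w l"])
    fix l assume l: "l \<in> {1..d}"
    show "strict_mono_on {a l..b l} (\<lambda>t. \<phi> l t - q i l * w l)"
    proof (rule strict_mono_onI)
      fix t u assume tu: "t \<in> {a l..b l}" "u \<in> {a l..b l}" "t < u"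
      show "\<phi> l t - q i l * w l < \<phi> l u - q i l * w l"
        using strict_mono_onD[OF mono[OF l] tu] bounds(1)[OF l tu(1)] by linarith
    qed
    fix t assume t: "t \<in> {a l..b l}"
    show "\<phi> l t - q i l * w l \<in> {a l..<a l + w l}"
      using bounds[OF l t] unfolding atLeastLessThan_iff by linarith
  next
    fix j assume j: "j \<in> Q"
    have "(\<lambda>l\<in>{1..d}. \<phi> l (j l) - q i l * w l) = (\<lambda>l\<in>{1..d}. x j l)"
      by (intro restrict_ext) (simp add: val[OF j] same[OF j])
    also have "\<dots> = x j"
      using X xX[OF j] by (intro PiE_restrict) blast
    finally show "(\<lambda>l\<in>{1..d}. \<phi> l (j l) - q i l * w l) \<in> X" using xX[OF j] by simp
  qed
qed

section \<open>The blow-up and its size\<close>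

text \<open>A copy of \<open>Q\<close> meets \<open>X\<close> only inside the product of the target
  ranges, so the rest of \<open>X\<close> can be discarded. This removes the shell from the large
  set.\<close>

lemma occurs_mono:
  assumes "occurs d I J Q X" "\<And>l. l \<in> {1..d} \<Longrightarrow> J l \<subseteq> J' l"
    "X \<inter> (\<Pi>\<^sub>E l\<in>{1..d}. J l) \<subseteq> X'" "Q \<subseteq> (\<Pi> l\<in>{1..d}. I l)"
  shows "occurs d I J' Q X'"
proof -
  obtain \<phi> where mono: "\<And>l. l \<in> {1..d} \<Longrightarrow> strict_mono_on (I l) (\<phi> l)"
    and mem: "\<And>l t. l \<in> {1..d} \<Longrightarrow> t \<in> I l \<Longrightarrow> \<phi> l t \<in> J l"
    and X: "\<And>j. j \<in> Q \<Longrightarrow> (\<lambda>l\<in>{1..d}. \<phi> l (j l)) \<in> X"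
    using assms(1) by (rule occursE) (rule that)
  have "(\<lambda>l\<in>{1..d}. \<phi> l (j l)) \<in> X'" if j: "j \<in> Q" for j
  proof -
    have "(\<lambda>l\<in>{1..d}. \<phi> l (j l)) \<in> (\<Pi>\<^sub>E l\<in>{1..d}. J l)"
      using Pi_mem[OF subsetD[OF assms(4) j]] by (intro restrict_PiE_iff[THEN iffD2] ballI mem)
    then show ?thesis using X[OF j] assms(3) by blast
  qed
  moreover have "\<phi> l t \<in> J' l" if "l \<in> {1..d}" "t \<in> I l" for l t
    using mem[OF that] assms(2)[OF that(1)] by blast
  ultimately show ?thesis using mono by (intro occursI[of d _ \<phi>])
qed

lemma blow_up_avoiding_set:
  assumes d: "d \<ge> 1" and s: "s \<ge> 1"
    and ab: "\<And>l. l \<in> {1..d} \<Longrightarrow> 1 \<le> a l \<and> a l \<le> b l \<and> b l \<le> k l"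
    and Q: "Q \<subseteq> (\<Pi> l\<in>{1..d}. {a l..b l})"
    and Qa: "\<And>l. l \<in> {1..d} \<Longrightarrow> \<exists>j\<in>Q. j l = a l"
    and Qb: "\<And>l. l \<in> {1..d} \<Longrightarrow> \<exists>j\<in>Q. j l = b l"
    and i: "i \<in> Q" "\<And>l. l \<in> {1..d} \<Longrightarrow> i l = a l \<or> i l = b l"
    and X: "X \<subseteq> index_box d (\<lambda>_. n)"
    and avoid: "\<not> occurs d (\<lambda>l. {1..k l}) (\<lambda>l. {1..n}) Q X"
  obtains Y where "Y \<subseteq> index_box d (\<lambda>_. s * n)"
    "\<not> occurs d (\<lambda>l. {1..k l}) (\<lambda>l. {1..s * n}) Q Y"
    "s ^ (d - 1) * card X \<le> fact (d - 1) * card Y"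
proof -
  \<comment> \<open>In direction \<open>l\<close> the shell has \<open>a l - 1\<close> slices below
    and \<open>k l - b l\<close> above; \<open>w l\<close> is the width left for the core. If
    \<open>n\<close> is too small, truncation gives width 0 and an empty core.\<close>
  define c where "c l = a l - 1 + (k l - b l)" for l
  define w where "w l = n - c l" for l
  define C where "C m = (\<Pi>\<^sub>E l\<in>{1..d}. {a l..m - (k l - b l)})" for m
  obtain N where N: "N \<subseteq> {1..d} \<rightarrow>\<^sub>E {..<s}" and cardN: "s ^ (d - 1) \<le> fact (d - 1) * card N"
    and anti: "\<forall>p\<in>N. \<forall>q\<in>N.
      (\<forall>l\<in>{1..d}. if i l = a l then p l \<le> q l else q l \<le> p l) \<longrightarrow> p = q"
    using ex_large_antichain[OF d s, of "\<lambda>l. i l = a l"] .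
  define Z where "Z = (\<Union>q\<in>N. shift d w q ` (X \<inter> C n))"
  define Y where "Y = (index_box d (\<lambda>_. s * n) - C (s * n)) \<union> Z"
  have Cn_eq: "{a l..n - (k l - b l)} = {a l..<a l + w l}" if "l \<in> {1..d}" for l
    using ab[OF that] by (auto simp: w_def c_def)
  have C_eq: "C n = (\<Pi>\<^sub>E l\<in>{1..d}. {a l..<a l + w l})"
    unfolding C_def using Cn_eq by (rule PiE_cong)
  have Cn: "X \<inter> C n \<subseteq> (\<Pi>\<^sub>E l\<in>{1..d}. {a l..<a l + w l})"
    unfolding C_eq by (rule Int_lower2)
  have C_box: "C m \<subseteq> index_box d (\<lambda>_. m)" for m
    unfolding C_def index_box_def by (intro PiE_mono) (use ab in force)
  have cardC: "card (C m) = (\<Prod>l\<in>{1..d}. m - c l)" for m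
    unfolding C_def by (subst card_PiE, simp) (intro prod.cong refl, use ab in \<open>force simp: c_def\<close>)
  have card_box: "card (index_box d (\<lambda>_. m)) = m ^ d" for m
    unfolding index_box_def by (simp add: card_PiE)
  have finC: "finite (C m)" for m using finite_subset[OF C_box finite_index_box] .
  have Z_C: "Z \<subseteq> C (s * n)"
  proof (unfold Z_def, intro UN_least image_subsetI)
    fix q x assume q: "q \<in> N" and x: "x \<in> X \<inter> C n"
    have "x l + q l * w l \<in> {a l..s * n - (k l - b l)}" if l: "l \<in> {1..d}" for l
    proof -
      \<comment> \<open>The last block has index \<open>s - 1\<close>, so translation adds at most
        \<open>(s - 1) * n\<close>, and the upper shell of thickness \<open>k l - b l\<close> stays
        free.\<close>
      have "q l < s" using N q l by blast
      then have "Suc (q l) * n \<le> s * n" by (intro mult_le_mono1) simp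
      then have "n + q l * n \<le> s * n" by simp
      moreover have "q l * w l \<le> q l * n" by (simp add: w_def)
      moreover have xl: "x l \<in> {a l..n - (k l - b l)}" using x l unfolding C_def by blast
      then have "x l + (k l - b l) \<le> n" using ab[OF l] by auto
      ultimately have "x l + q l * w l + (k l - b l) \<le> s * n" by linarith
      then show ?thesis using xl by auto
    qed
    then show "shift d w q x \<in> C (s * n)"
      unfolding shift_def C_def by (intro restrict_PiE_iff[THEN iffD2] ballI)
  qed
  have finZ: "finite Z" using Z_C finC finite_subset by blast
  have "Z = (\<lambda>(q, x). shift d w q x) ` (N \<times> (X \<inter> C n))" unfolding Z_def by auto
  then have cardZ: "card Z = card N * card (X \<inter> C n)"
    using card_image[OF inj_on_shift[OF N Cn]] by (simp add: card_cartesian_product)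
  have "card Y = card (index_box d (\<lambda>_. s * n) - C (s * n)) + card Z"
    unfolding Y_def using Z_C finZ finite_index_box by (intro card_Un_disjoint) auto
  also have "card (index_box d (\<lambda>_. s * n) - C (s * n)) = (s * n) ^ d - (\<Prod>l\<in>{1..d}. s * n - c l)"
    using card_Diff_subset[OF finC C_box] by (simp add: card_box cardC)
  finally have cardY: "card Y =
      ((s * n) ^ d - (\<Prod>l\<in>{1..d}. s * n - c l)) + card N * card (X \<inter> C n)"
    by (simp add: cardZ)
  \<comment> \<open>Outside the core, \<open>X\<close> is bounded by the whole shell.\<close>
  have "card X \<le> card (X \<inter> C n) + card (index_box d (\<lambda>_. n) - C n)"
  proof -
    have "X \<subseteq> (X \<inter> C n) \<union> (index_box d (\<lambda>_. n) - C n)" using X by blast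
    then have "card X \<le> card ((X \<inter> C n) \<union> (index_box d (\<lambda>_. n) - C n))"
      using finC finite_index_box by (intro card_mono) auto
    then show ?thesis using card_Un_le le_trans by blast
  qed
  also have "card (index_box d (\<lambda>_. n) - C n) = n ^ d - (\<Prod>l\<in>{1..d}. n - c l)"
    using card_Diff_subset[OF finC C_box] by (simp add: card_box cardC)
  finally have cardX: "card X \<le> card (X \<inter> C n) + (n ^ d - (\<Prod>l\<in>{1..d}. n - c l))" .
  have "s * (s ^ (d - 1) * (n ^ d - (\<Prod>l\<in>{1..d}. n - c l))) =
      s ^ d * (n ^ d - (\<Prod>l\<in>{1..d}. n - c l))"
    using d by (simp add: power_eq_if[of s d] mult.assoc)
  also have "\<dots> \<le> s * ((s * n) ^ d - (\<Prod>l\<in>{1..d}. s * n - c l))"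
    using shell_scaling[of "{1..d}" s n c] s by simp
  finally have shell: "s ^ (d - 1) * (n ^ d - (\<Prod>l\<in>{1..d}. n - c l)) \<le>
      (s * n) ^ d - (\<Prod>l\<in>{1..d}. s * n - c l)"
    using s by simp
  have "s ^ (d - 1) * card X \<le>
      s ^ (d - 1) * card (X \<inter> C n) + s ^ (d - 1) * (n ^ d - (\<Prod>l\<in>{1..d}. n - c l))"
    using mult_le_mono2[OF cardX] by (simp add: add_mult_distrib2)
  \<comment> \<open>The size of the antichain pays for the core part; the shell already grows by
    \<open>s ^ (d - 1)\<close>, so there the factorial is only a factor at least 1.\<close>
  also have "\<dots> \<le> fact (d - 1) * card N * card (X \<inter> C n) +
      fact (d - 1) * ((s * n) ^ d - (\<Prod>l\<in>{1..d}. s * n - c l))"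
  proof (intro add_mono mult_le_mono1 cardN)
    have "1 * ((s * n) ^ d - (\<Prod>l\<in>{1..d}. s * n - c l)) \<le>
        fact (d - 1) * ((s * n) ^ d - (\<Prod>l\<in>{1..d}. s * n - c l))"
      by (intro mult_le_mono1 fact_ge_1)
    then show "s ^ (d - 1) * (n ^ d - (\<Prod>l\<in>{1..d}. n - c l)) \<le>
        fact (d - 1) * ((s * n) ^ d - (\<Prod>l\<in>{1..d}. s * n - c l))"
      using shell by linarith
  qed
  also have "\<dots> = fact (d - 1) * card Y"
    unfolding cardY by (simp only: add_mult_distrib2 mult.assoc add.commute)
  finally have card: "s ^ (d - 1) * card X \<le> fact (d - 1) * card Y" .
  have core: "occurs d (\<lambda>l. {1..k l}) (\<lambda>l. {1..m}) Q V \<longleftrightarrow>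
      occurs d (\<lambda>l. {a l..b l}) (\<lambda>l. {a l..m - (k l - b l)}) Q V" for m V
    using ab Q by (rule occurs_core_iff)
  have "\<not> occurs d (\<lambda>l. {1..k l}) (\<lambda>l. {1..s * n}) Q Y"
  proof
    assume "occurs d (\<lambda>l. {1..k l}) (\<lambda>l. {1..s * n}) Q Y"
    then have "occurs d (\<lambda>l. {a l..b l}) (\<lambda>l. {a l..s * n - (k l - b l)}) Q Y"
      unfolding core .
    \<comment> \<open>Inside the large core, \<open>Y\<close> and \<open>Z\<close> coincide.\<close>
    then have occ: "occurs d (\<lambda>l. {a l..b l}) (\<lambda>l. {a l..s * n - (k l - b l)}) Q Z"
      by (rule occurs_mono[OF _ order_refl _ Q]) (auto simp: Y_def C_def)
    have "occurs d (\<lambda>l. {a l..b l}) (\<lambda>l. {a l..<a l + w l}) Q (X \<inter> C n)"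
      using Q Qa Qb i Cn anti occ[unfolded Z_def] by (rule occurs_shifts_imp_occurs)
    then have "occurs d (\<lambda>l. {a l..b l}) (\<lambda>l. {a l..n - (k l - b l)}) Q X"
      by (rule occurs_mono[OF _ _ _ Q]) (auto simp: Cn_eq)
    then show False using avoid unfolding core by contradiction
  qed
  moreover have "Y \<subseteq> index_box d (\<lambda>_. s * n)"
    unfolding Y_def by (rule Un_least[OF Diff_subset subset_trans[OF Z_C C_box]])
  ultimately show thesis using card by (intro that)
qed

section \<open>Back to matrices and the extremal number\<close>

lemma zero_one_indicator:
  assumes "X \<subseteq> index_box d m"
  obtains A where "zero_one_matrix d m A" "ones d m A = X"
proof -
  let ?A = "\<lambda>i\<in>index_box d m. if i \<in> X then 1 else 0 :: nat"
  have "zero_one_matrix d m ?A" by (auto simp: zero_one_matrix_def)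
  moreover have "ones d m ?A = X" using assms by (auto simp: ones_def)
  ultimately show thesis by (rule that)
qed

lemma finite_num_ones_avoiding:
  "finite {num_ones d m A |A. zero_one_matrix d m A \<and> avoids d m A k P}"
proof (rule finite_subset)
  show "finite (num_ones d m ` (index_box d m \<rightarrow>\<^sub>E {0, 1}))"
    by (intro finite_imageI finite_PiE finite_index_box) simp
qed (auto simp: zero_one_matrix_def)

lemma num_ones_le_ex_num:
  assumes "zero_one_matrix d (\<lambda>_. n) A" "avoids d (\<lambda>_. n) A k P"
  shows "num_ones d (\<lambda>_. n) A \<le> ex_num n k P d"
  unfolding ex_num_def using assms by (intro Max_ge finite_num_ones_avoiding) blast

text \<open>The zero matrix avoids any \<open>P\<close> with a 1-entry, so the maximum is taken over
  a nonempty finite set.\<close>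

lemma ex_num_attained:
  assumes P: "zero_one_matrix d k P" "ones d k P \<noteq> {}"
  obtains A where "zero_one_matrix d (\<lambda>_. n) A" "avoids d (\<lambda>_. n) A k P"
    "num_ones d (\<lambda>_. n) A = ex_num n k P d"
proof -
  obtain A where A: "zero_one_matrix d (\<lambda>_. n) A" "ones d (\<lambda>_. n) A = {}"
    using zero_one_indicator[of "{}"] by blast
  have "avoids d (\<lambda>_. n) A k P"
    unfolding contains_iff_occurs[OF A(1) P(1)] A(2) using P(2) by (auto simp: occurs_def)
  then have "ex_num n k P d \<in>
      {num_ones d (\<lambda>_. n) A |A. zero_one_matrix d (\<lambda>_. n) A \<and> avoids d (\<lambda>_. n) A k P}"
    unfolding ex_num_def using A(1) by (intro Max_in finite_num_ones_avoiding) blast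
  then show thesis using that by auto
qed

theorem lemma4p7:
  fixes d s n :: nat and k :: "nat \<Rightarrow> nat" and P :: "(nat \<Rightarrow> nat) \<Rightarrow> nat"
  assumes "d \<ge> 1"
    and "zero_one_matrix d k P"
    and "has_corner_one d k P"
    and "s \<ge> 1"
    and "n \<ge> 1"
  shows "real (ex_num (s * n) k P d) \<ge> real s ^ (d - 1) / fact (d - 1) * real (ex_num n k P d)"
proof -
  note P = assms(2)
  let ?Q = "ones d k P"
  obtain i where i: "i \<in> ?Q" and corner: "\<And>l. l \<in> {1..d} \<Longrightarrow> i l = 1 \<or> i l = k l"
    using assms(3) by (auto simp: has_corner_one_def corner_index_def ones_def)
  define a where "a l = Min ((\<lambda>j. j l) ` ?Q)" for l
  define b where "b l = Max ((\<lambda>j. j l) ` ?Q)" for l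
  have fin: "finite ((\<lambda>j. j l) ` ?Q)" for l
    using finite_subset[OF _ finite_index_box[of d k], of ?Q] by (auto simp: ones_def)
  have ne: "(\<lambda>j. j l) ` ?Q \<noteq> {}" for l using i by blast
  have Qk: "j l \<in> {1..k l}" if "j \<in> ?Q" "l \<in> {1..d}" for j l
    using that unfolding ones_def index_box_def by blast
  have Qa: "\<exists>j\<in>?Q. j l = a l" if "l \<in> {1..d}" for l
    using Min_in[OF fin ne, of l] by (auto simp: a_def)
  have Qb: "\<exists>j\<in>?Q. j l = b l" if "l \<in> {1..d}" for l
    using Max_in[OF fin ne, of l] by (auto simp: b_def)
  have range: "j l \<in> {a l..b l}" if "j \<in> ?Q" for j l
    unfolding a_def b_def atLeastAtMost_iff using that fin
    by (intro conjI Min_le Max_ge imageI)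
  then have Q: "?Q \<subseteq> (\<Pi> l\<in>{1..d}. {a l..b l})" by (intro subsetI Pi_I)
  have ab: "1 \<le> a l \<and> a l \<le> b l \<and> b l \<le> k l" if l: "l \<in> {1..d}" for l
  proof -
    obtain j j' where j: "j \<in> ?Q" "j l = a l" "j' \<in> ?Q" "j' l = b l" using Qa[OF l] Qb[OF l] by blast
    then show ?thesis using Qk[OF j(1) l] Qk[OF j(3) l] range[OF j(1), of l] by simp
  qed
  \<comment> \<open>A corner of \<open>P\<close> that is a 1-entry is a corner of the bounding box:
    \<open>1 \<le> a l \<le> i l\<close> and \<open>i l \<le> b l \<le> k l\<close> collapse at the
    respective end.\<close>
  have corner': "i l = a l \<or> i l = b l" if l: "l \<in> {1..d}" for l
    using corner[OF l] ab[OF l] range[OF i, of l] by auto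
  obtain A where A: "zero_one_matrix d (\<lambda>_. n) A" and av: "avoids d (\<lambda>_. n) A k P"
    and max: "num_ones d (\<lambda>_. n) A = ex_num n k P d"
    using ex_num_attained[OF P] i by blast
  have sub: "ones d (\<lambda>_. n) A \<subseteq> index_box d (\<lambda>_. n)" by (auto simp: ones_def)
  obtain Y where Y: "Y \<subseteq> index_box d (\<lambda>_. s * n)"
    "\<not> occurs d (\<lambda>l. {1..k l}) (\<lambda>l. {1..s * n}) ?Q Y"
    and card: "s ^ (d - 1) * card (ones d (\<lambda>_. n) A) \<le> fact (d - 1) * card Y"
    using blow_up_avoiding_set[where a = a and b = b and k = k and Q = ?Q and i = i and d = d
        and s = s and n = n, OF assms(1,4) ab Q Qa Qb i corner' sub
        av[unfolded contains_iff_occurs[OF A P]]] .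
  obtain B where B: "zero_one_matrix d (\<lambda>_. s * n) B" "ones d (\<lambda>_. s * n) B = Y"
    using zero_one_indicator[OF Y(1)] .
  have "card Y \<le> ex_num (s * n) k P d"
    using num_ones_le_ex_num[OF B(1)] Y(2)
    by (simp add: contains_iff_occurs[OF B(1) P] B(2) num_ones_eq_card_ones)
  then have "fact (d - 1) * card Y \<le> fact (d - 1) * ex_num (s * n) k P d"
    by (rule mult_le_mono2)
  with card have "s ^ (d - 1) * card (ones d (\<lambda>_. n) A) \<le> fact (d - 1) * ex_num (s * n) k P d"
    by (rule le_trans)
  then have "s ^ (d - 1) * ex_num n k P d \<le> fact (d - 1) * ex_num (s * n) k P d"
    by (simp add: num_ones_eq_card_ones flip: max)
  then have "real (s ^ (d - 1) * ex_num n k P d) \<le> real (fact (d - 1) * ex_num (s * n) k P d)"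
    by (rule of_nat_mono)
  then show ?thesis by (simp add: divide_le_eq mult.commute)
qed

end
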